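(* Let $\mathbb A=(A,(\mathrm{Con}_i)_{i\in A},(\vDash_i)_{i\in A})$ be a strong continuous information frame with truth element $\mathbf t$. Let $P^{\mathbb A}=A$ with $\top=\mathbf t$, form $\mathcal L(P^{\mathbb A})$ with the elements of $A$ as atomic propositions, and for $i\in A$, finite $\Gamma\subseteq\mathcal L(P^{\mathbb A})$ (or $\Gamma=\{i\}$) and $\varphi\in\mathcal L(P^{\mathbb A})$ put $P^{\mathbb A}_i=\{j\in A:\{i\}\vDash_i j\}$ and $\Gamma\vdash^i_{\mathbb A}\varphi$ iff $\overline\Gamma\in\mathrm{Con}_i$ and $\overline\Gamma\vDash_i\overline\varphi$. Then $\mathbb P^{\mathbb A}=(P^{\mathbb A},(P^{\mathbb A}_i)_{i\in P^{\mathbb A}},(\vdash^i_{\mathbb A})_{i\in P^{\mathbb A}})$ is a continuous stratified conjunctive logic such that for all $i\in A$: (1) for all $\Gamma\in\mathcal P_f(\mathcal L(P^{\mathbb A}_i))\cup\{\{i\}\}$ and $\varphi\in\mathcal L(P^{\mathbb A}_i)$, if $\Gamma\vdash^i_{\mathbb A}\varphi$ then $\overline\Gamma\in\mathrm{Con}_i$ and $\overline\Gamma\vDash_i\overline\varphi$; (2) for all $X\in\mathrm{Con}_i$ and finite $Y\subseteq A$, if $X\vDash_iY$ then $X\in\mathcal P_f(\mathcal L(P^{\mathbb A}_i))\cup\{\{i\}\}$ and $X\vdash^i_{\mathbb A}\bigwedge Y$.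
   Context: A continuous information frame is a triple $\mathbb{A}=(A,(\mathrm{Con}_i)_{i\in A},(\vDash_i)_{i\in A})$ where $A$ is a set, each $\mathrm{Con}_i$ is a set of finite subsets of $A$, and $\vDash_i\subseteq\mathrm{Con}_i\times A$; write $iRj$ iff $\{i\}\in\mathrm{Con}_j$, and $X\vDash_i Y$ iff $X\vDash_i b$ for all $b\in Y$. Required, for all $i,j,a\in A$ and finite $X,Y\subseteq A$: (i) $\{i\}\in\mathrm{Con}_i$; (ii) if $Y\subseteq X\in\mathrm{Con}_i$ then $Y\in\mathrm{Con}_i$; (iii) if $X\in\mathrm{Con}_i$ and $X\vDash_i Y$ then $Y\in\mathrm{Con}_i$; (iv) if $X,Y\in\mathrm{Con}_i$, $X\subseteq Y$, $X\vDash_i a$ then $Y\vDash_i a$; (v) if $X\in\mathrm{Con}_i$, $X\vDash_i Y$, $Y\vDash_i a$ then $X\vDash_i a$; (vi) if $iRj$ then $\mathrm{Con}_i\subseteq\mathrm{Con}_j$; (vii) if $iRj$, $X\in\mathrm{Con}_i$, $X\vDash_i a$ then $X\vDash_j a$; (viii) if $X\vDash_i Y$ then there exist $e\in A$, $Z\in\mathrm{Con}_e$ with $X\vDash_i \{e\}\cup Z$ and $Z\vDash_e Y$. It is strong if for all $i$ and $X\in\mathrm{Con}_i$ with $X\neq\{i\}$, $\{i\}\vDash_i X$. A token $\mathbf t$ is a truth element if $\emptyset\vDash_i\mathbf t$ for all $i$. Let $P$ be a set of atomic propositions containing a constant $\top$. For $Q\subseteq P$, $\mathcal L(Q)$ is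 the set of formulae built from elements of $Q$ by $\wedge$. For nonempty finite $\Gamma=\{\varphi_1,\dots,\varphi_n\}$, $\bigwedge\Gamma=\varphi_1\wedge\dots\wedge\varphi_n$ (bracketed left), $\bigwedge\emptyset=\top$. For a formula $\varphi$, $\overline\varphi$ is the set of atomic propositions occurring in $\varphi$; for a nonempty set $\Delta$ of formulae, $\overline\Delta=\bigcup_{\varphi\in\Delta}\overline\varphi$, and $\overline\emptyset$ is $\top$. A single formula $\varphi$ also stands for $\{\varphi\}$; atomic propositions are formulae, so finite subsets of $A$ are finite sets of formulae. $\mathcal P_f(M)$ is the set of finite subsets of $M$; "$\Delta,\varphi$" means $\Delta\cup\{\varphi\}$. A stratified conjunctive logic $\mathbb P=(P,(P_p)_{p\in P},(\vdash^p)_{p\in P})$ consists of such $P$, subsets $P_p\subseteq P$ and relations $\vdash^p\subseteq(\mathcal P_f(\mathcal L(P_p))\cup\{\{p\}\})\times\mathcal L(P_p)$ such that for all $p,q\in P$, $\Gamma\in\mathcal P_f(\mathcal L(P_p))\cup\{\{p\}\}$, $\Delta\in\mathcal P_f(\mathcal L(P_p))$ and $\varphi,\psi,\theta,\xi\in\mathcal L(P_p)$: (1) if $q\in P_p$ then $p\vdash^pq$; (2) if $q\vdash^qp$ then $P_p\subseteq P_q$; (3) if $q\vdash^qp$ and $\Gamma\vdash^p\theta$ then $\Gamma\vdash^q\theta$; (4) $\vdash^p$ is closed under: (R$\top$) $\Gamma\vdash^p\top$; (L$\wedge$) $\Delta,\varphi,\psi\vdash^p\theta$ iff $\Delta,\varphi\wedge\psi\vdash^p\theta$;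 (R$\wedge$) ($\Gamma\vdash^p\varphi$ and $\Gamma\vdash^p\psi$) iff $\Gamma\vdash^p\varphi\wedge\psi$; (Cut) $\Gamma\vdash^p\varphi$ and $\varphi\vdash^p\psi$ imply $\Gamma\vdash^p\psi$; (W) $\Delta\vdash^p\varphi$ implies $\Delta,\xi\vdash^p\varphi$. It is continuous if (INT): whenever $\Gamma\vdash^p\varphi$ (with $\Gamma\in\mathcal P_f(\mathcal L(P_p))\cup\{\{p\}\}$, $\varphi\in\mathcal L(P_p)$) there are $r\in P_p$ and $\xi\in\mathcal L(P_r)$ with $\Gamma\vdash^pr\wedge\xi$ and $\xi\vdash^r\varphi$.
   Formalization: The entailment of the logic is the displayed one restricted to Γ in P_f(L(P_i)) ∪ {{i}} and φ in L(P_i); unrestricted it need not have the required type: if {i} does not entail i, then {i∧i} entails ⊤ at i, though {i∧i} is not an allowed antecedent. *)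

theory Defs
  imports Main
begin

locale continuous_information_frame =
  fixes A :: "'a set"
    and Con :: "'a \<Rightarrow> 'a set set"
    and ent :: "'a \<Rightarrow> 'a set \<Rightarrow> 'a \<Rightarrow> bool"
  assumes Con_subset: "i \<in> A \<Longrightarrow> Con i \<subseteq> Fpow A"
    and ent_typed: "\<lbrakk>i \<in> A; ent i X a\<rbrakk> \<Longrightarrow> X \<in> Con i \<and> a \<in> A"
    and Con_self: "i \<in> A \<Longrightarrow> {i} \<in> Con i"
    and Con_mono: "\<lbrakk>i \<in> A; X \<in> Con i; Y \<subseteq> X\<rbrakk> \<Longrightarrow> Y \<in> Con i"
    and Con_ent: "\<lbrakk>i \<in> A; Y \<in> Fpow A; X \<in> Con i; \<forall>b\<in>Y. ent i X b\<rbrakk> \<Longrightarrow> Y \<in> Con i"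
    and ent_weaken: "\<lbrakk>i \<in> A; a \<in> A; X \<in> Con i; Y \<in> Con i; X \<subseteq> Y; ent i X a\<rbrakk> \<Longrightarrow> ent i Y a"
    and ent_cut: "\<lbrakk>i \<in> A; a \<in> A; Y \<in> Fpow A; X \<in> Con i; \<forall>b\<in>Y. ent i X b; ent i Y a\<rbrakk> \<Longrightarrow> ent i X a"
    and Con_transfer: "\<lbrakk>i \<in> A; j \<in> A; {i} \<in> Con j\<rbrakk> \<Longrightarrow> Con i \<subseteq> Con j"
    and ent_transfer:
      "\<lbrakk>i \<in> A; j \<in> A; a \<in> A; {i} \<in> Con j; X \<in> Con i; ent i X a\<rbrakk> \<Longrightarrow> ent j X a"
    \<comment> \<open>\<open>X \<in> Con i\<close> is an explicit premise here because for \<open>Y = {}\<close> it does not follow from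
        \<open>\<forall>b\<in>Y. ent i X b\<close>.\<close>
    and ent_interpolate:
      "\<lbrakk>i \<in> A; X \<in> Con i; Y \<in> Fpow A; \<forall>b\<in>Y. ent i X b\<rbrakk> \<Longrightarrow>
        \<exists>e\<in>A. \<exists>Z\<in>Con e. (\<forall>b\<in>{e} \<union> Z. ent i X b) \<and> (\<forall>b\<in>Y. ent e Z b)"

locale strong_continuous_information_frame = continuous_information_frame +
  assumes strong: "\<lbrakk>i \<in> A; X \<in> Con i; X \<noteq> {i}\<rbrakk> \<Longrightarrow> \<forall>b\<in>X. ent i {i} b"

definition truth_element :: "'a set \<Rightarrow> ('a \<Rightarrow> 'a set \<Rightarrow> 'a \<Rightarrow> bool) \<Rightarrow> 'a \<Rightarrow> bool" where
  "truth_element A ent t \<longleftrightarrow> t \<in> A \<and> (\<forall>i\<in>A. ent i {} t)"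

datatype (atoms: 'a) form = Atom 'a | And "'a form" "'a form" (infixr "\<^bold>\<and>" 55)

inductive_set formulae :: "'a set \<Rightarrow> 'a form set" for Q :: "'a set" where
  Atom: "q \<in> Q \<Longrightarrow> Atom q \<in> formulae Q"
| And: "\<lbrakk>\<phi> \<in> formulae Q; \<psi> \<in> formulae Q\<rbrakk> \<Longrightarrow> \<phi> \<^bold>\<and> \<psi> \<in> formulae Q"

text \<open>The conjunction of a finite set depends on an enumeration of it, so it is defined on lists;
  it is bracketed to the left.\<close>

fun big_and :: "'a \<Rightarrow> 'a form list \<Rightarrow> 'a form" where
  "big_and verum [] = Atom verum"
| "big_and verum (\<phi> # \<phi>s) = foldl And \<phi> \<phi>s"

text \<open>The empty set of formulae counts as \<open>verum\<close> (the constant \<open>\<top>\<close>), so its set of atoms is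
  \<open>{verum}\<close>, not \<open>{}\<close>.\<close>

definition atoms_of_set :: "'a \<Rightarrow> 'a form set \<Rightarrow> 'a set" where
  "atoms_of_set verum \<Delta> = (if \<Delta> = {} then {verum} else (\<Union>\<phi>\<in>\<Delta>. atoms \<phi>))"

definition antecedents :: "('a \<Rightarrow> 'a set) \<Rightarrow> 'a \<Rightarrow> 'a form set set" where
  "antecedents Ps p = Fpow (formulae (Ps p)) \<union> {{Atom p}}"

locale stratified_conjunctive_logic =
  fixes P :: "'a set"
    and verum :: 'a
    and Ps :: "'a \<Rightarrow> 'a set"
    and turnstile :: "'a \<Rightarrow> 'a form set \<Rightarrow> 'a form \<Rightarrow> bool"
  assumes verum_in: "verum \<in> P"
    and Ps_subset: "p \<in> P \<Longrightarrow> Ps p \<subseteq> P"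
    and typed: "\<lbrakk>p \<in> P; turnstile p \<Gamma> \<phi>\<rbrakk> \<Longrightarrow> \<Gamma> \<in> antecedents Ps p \<and> \<phi> \<in> formulae (Ps p)"
    and self: "\<lbrakk>p \<in> P; q \<in> P; q \<in> Ps p\<rbrakk> \<Longrightarrow> turnstile p {Atom p} (Atom q)"
    and Ps_mono: "\<lbrakk>p \<in> P; q \<in> P; turnstile q {Atom q} (Atom p)\<rbrakk> \<Longrightarrow> Ps p \<subseteq> Ps q"
    and transfer:
      "\<lbrakk>p \<in> P; q \<in> P; \<Gamma> \<in> antecedents Ps p; \<theta> \<in> formulae (Ps p);
        turnstile q {Atom q} (Atom p); turnstile p \<Gamma> \<theta>\<rbrakk> \<Longrightarrow> turnstile q \<Gamma> \<theta>"
    and R_top: "\<lbrakk>p \<in> P; \<Gamma> \<in> antecedents Ps p\<rbrakk> \<Longrightarrow> turnstile p \<Gamma> (Atom verum)"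
    and L_and:
      "\<lbrakk>p \<in> P; \<Delta> \<in> Fpow (formulae (Ps p));
        \<phi> \<in> formulae (Ps p); \<psi> \<in> formulae (Ps p); \<theta> \<in> formulae (Ps p)\<rbrakk> \<Longrightarrow>
        turnstile p (\<Delta> \<union> {\<phi>, \<psi>}) \<theta> \<longleftrightarrow> turnstile p (\<Delta> \<union> {\<phi> \<^bold>\<and> \<psi>}) \<theta>"
    and R_and:
      "\<lbrakk>p \<in> P; \<Gamma> \<in> antecedents Ps p; \<phi> \<in> formulae (Ps p); \<psi> \<in> formulae (Ps p)\<rbrakk> \<Longrightarrow>
        turnstile p \<Gamma> \<phi> \<and> turnstile p \<Gamma> \<psi> \<longleftrightarrow> turnstile p \<Gamma> (\<phi> \<^bold>\<and> \<psi>)"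
    and Cut:
      "\<lbrakk>p \<in> P; \<Gamma> \<in> antecedents Ps p; \<phi> \<in> formulae (Ps p); \<psi> \<in> formulae (Ps p);
        turnstile p \<Gamma> \<phi>; turnstile p {\<phi>} \<psi>\<rbrakk> \<Longrightarrow> turnstile p \<Gamma> \<psi>"
    and W:
      "\<lbrakk>p \<in> P; \<Delta> \<in> Fpow (formulae (Ps p)); \<phi> \<in> formulae (Ps p); \<xi> \<in> formulae (Ps p);
        turnstile p \<Delta> \<phi>\<rbrakk> \<Longrightarrow> turnstile p (\<Delta> \<union> {\<xi>}) \<phi>"

locale continuous_stratified_conjunctive_logic = stratified_conjunctive_logic +
  assumes INT:
    "\<lbrakk>p \<in> P; \<Gamma> \<in> antecedents Ps p; \<phi> \<in> formulae (Ps p); turnstile p \<Gamma> \<phi>\<rbrakk> \<Longrightarrow>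
      \<exists>r\<in>Ps p. \<exists>\<xi>\<in>formulae (Ps r). turnstile p \<Gamma> (Atom r \<^bold>\<and> \<xi>) \<and> turnstile r {\<xi>} \<phi>"

definition frame_props :: "'a set \<Rightarrow> ('a \<Rightarrow> 'a set \<Rightarrow> 'a \<Rightarrow> bool) \<Rightarrow> 'a \<Rightarrow> 'a set" where
  "frame_props A ent i = {j \<in> A. ent i {i} j}"

definition frame_entails ::
  "'a set \<Rightarrow> ('a \<Rightarrow> 'a set set) \<Rightarrow> ('a \<Rightarrow> 'a set \<Rightarrow> 'a \<Rightarrow> bool) \<Rightarrow> 'a \<Rightarrow>
    'a \<Rightarrow> 'a form set \<Rightarrow> 'a form \<Rightarrow> bool" where
  "frame_entails A Con ent t i \<Gamma> \<phi> \<longleftrightarrow>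
    (\<Gamma> \<in> Fpow (formulae A) \<or> \<Gamma> = {Atom i}) \<and> \<phi> \<in> formulae A \<and>
    atoms_of_set t \<Gamma> \<in> Con i \<and> (\<forall>b\<in>atoms \<phi>. ent i (atoms_of_set t \<Gamma>) b)"

text \<open>The entailment relation of a stratified conjunctive logic only relates antecedents in
  \<open>antecedents Ps i\<close> to formulae over \<open>Ps i\<close>, so the relation of the frame logic is
  \<open>frame_entails\<close> restricted to such pairs. The restriction matters only for antecedents such as
  \<open>{Atom i \<^bold>\<and> Atom i}\<close> with \<open>\<not> ent i {i} i\<close>: their set of atoms is \<open>{i} \<in> Con i\<close>, but they are
  neither \<open>{Atom i}\<close> nor sets of formulae over \<open>frame_props A ent i\<close>.\<close>

definition frame_turnstile ::
  "'a set \<Rightarrow> ('a \<Rightarrow> 'a set set) \<Rightarrow> ('a \<Rightarrow> 'a set \<Rightarrow> 'a \<Rightarrow> bool) \<Rightarrow> 'a \<Rightarrow>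
    'a \<Rightarrow> 'a form set \<Rightarrow> 'a form \<Rightarrow> bool" where
  "frame_turnstile A Con ent t i \<Gamma> \<phi> \<longleftrightarrow>
    \<Gamma> \<in> antecedents (frame_props A ent) i \<and> \<phi> \<in> formulae (frame_props A ent i) \<and>
    frame_entails A Con ent t i \<Gamma> \<phi>"

end

theory Submission
  imports Defs
begin

text \<open>Since \<open>{i} \<Turnstile>\<^sub>i b\<close> for all \<open>b\<close> in a consistent set other than \<open>{i}\<close>, the sets in
  \<open>Con i\<close> are exactly \<open>{i}\<close> and the finite sets of atoms of \<open>P\<^sub>i\<close>, so every admissible
  antecedent is automatically consistent and derivability is plain entailment between sets of atoms.
  The rules then translate into the frame axioms. For interpolation one application of the frame
  axiom is not enough: it yields \<open>e\<close> and \<open>Z \<in> Con e\<close>, but \<open>Z\<close> may be \<open>{e}\<close> with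
  \<open>e \<notin> P\<^sub>e\<close>, in which case its conjunction is not a formula over \<open>P\<^sub>e\<close>. Interpolating
  once more between \<open>Z\<close> and the conclusion in \<open>e\<close> gives a set of elements of \<open>P\<^sub>e\<close>.\<close>

section \<open>Atoms of formulae and of conjunctions\<close>

lemma formulae_iff: "\<phi> \<in> formulae Q \<longleftrightarrow> atoms \<phi> \<subseteq> Q"
proof
  show "\<phi> \<in> formulae Q \<Longrightarrow> atoms \<phi> \<subseteq> Q"
    by (induction rule: formulae.induct) auto
  show "atoms \<phi> \<subseteq> Q \<Longrightarrow> \<phi> \<in> formulae Q"
    by (induction \<phi>) (auto intro: formulae.intros)
qed

lemma finite_atoms [simp]: "finite (atoms \<phi>)"
  by (induction \<phi>) auto

lemma atoms_foldl_And: "atoms (foldl And \<phi> \<phi>s) = atoms \<phi> \<union> (\<Union>\<psi>\<in>set \<phi>s. atoms \<psi>)"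
  by (induction \<phi>s arbitrary: \<phi>) auto

lemma atoms_big_and: "atoms (big_and v \<phi>s) = atoms_of_set v (set \<phi>s)"
  by (cases \<phi>s) (auto simp: atoms_of_set_def atoms_foldl_And)

text \<open>This turns a finite set of tokens into a single formula, as interpolation requires.
  Every formula has at least one atom, which is why \<open>X\<close> is nonempty.\<close>

lemma ex_formula_with_atoms:
  assumes "finite X" and "X \<noteq> {}"
  shows "\<exists>\<phi>. atoms \<phi> = X"
proof -
  obtain xs where "set xs = X"
    using finite_list[OF \<open>finite X\<close>] by blast
  \<comment> \<open>The first argument of \<open>big_and\<close> is the value for the empty list
    only, a case that \<open>X \<noteq> {}\<close> excludes.\<close>
  then have "atoms (big_and undefined (map Atom xs)) = X"
    using \<open>X \<noteq> {}\<close> by (auto simp: atoms_big_and atoms_of_set_def)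
  then show ?thesis ..
qed

lemma Fpow_formulae_atoms: "\<Gamma> \<in> Fpow (formulae Q) \<Longrightarrow> (\<Union>\<phi>\<in>\<Gamma>. atoms \<phi>) \<in> Fpow Q"
  by (fastforce simp: Fpow_def formulae_iff)

section \<open>Consistency and entailment in a strong frame\<close>

locale strong_frame_with_truth = strong_continuous_information_frame A Con ent
  for A :: "'a set" and Con :: "'a \<Rightarrow> 'a set set" and ent :: "'a \<Rightarrow> 'a set \<Rightarrow> 'a \<Rightarrow> bool" +
  fixes t :: 'a
  assumes truth: "truth_element A ent t"
begin

abbreviation props :: "'a \<Rightarrow> 'a set" where
  "props \<equiv> frame_props A ent"

abbreviation derives :: "'a \<Rightarrow> 'a form set \<Rightarrow> 'a form \<Rightarrow> bool" where
  "derives \<equiv> frame_turnstile A Con ent t"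

lemma t_in: "t \<in> A"
  using truth by (simp add: truth_element_def)

lemma props_iff: "i \<in> A \<Longrightarrow> j \<in> props i \<longleftrightarrow> ent i {i} j"
  using ent_typed by (auto simp: frame_props_def)

lemma props_subset: "props i \<subseteq> A"
  by (auto simp: frame_props_def)

lemma Con_props:
  assumes "i \<in> A" and "X \<in> Fpow (props i)"
  shows "X \<in> Con i"
proof -
  have "X \<in> Fpow A"
    using assms(2) props_subset unfolding Fpow_def by blast
  moreover have "\<forall>b\<in>X. ent i {i} b"
    using assms by (auto simp: Fpow_def props_iff)
  ultimately show ?thesis
    using Con_ent Con_self assms(1) by blast
qed

text \<open>Strongness gives the second alternative. The set \<open>{i}\<close> has to stay a
  separate case because \<open>i\<close> need not entail itself.\<close>

lemma Con_cases:
  assumes "i \<in> A" and "X \<in> Con i"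
  shows "X = {i} \<or> X \<in> Fpow (props i)"
proof (cases "X = {i}")
  case False
  then have "\<forall>b\<in>X. ent i {i} b"
    using strong assms by blast
  moreover have "finite X"
    using Con_subset assms by (auto simp: Fpow_def)
  ultimately show ?thesis
    using assms(1) by (auto simp: Fpow_def props_iff)
qed simp

lemma cut:
  assumes "i \<in> A" and "X \<in> Con i" and "Y \<in> Con i"
    and "\<forall>b\<in>Y. ent i X b" and "ent i Y a"
  shows "ent i X a"
proof -
  have "Y \<in> Fpow A" and "a \<in> A"
    using Con_subset ent_typed assms by blast+
  then show ?thesis
    using ent_cut assms by blast
qed

text \<open>By strongness \<open>{i}\<close> entails every element of \<open>X\<close> unless
  \<open>X\<close> is \<open>{i}\<close> itself, so a cut through \<open>X\<close> replaces the
  antecedent by \<open>{i}\<close>.\<close>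

lemma ent_props:
  assumes "i \<in> A" and "ent i X a"
  shows "a \<in> props i"
proof -
  have X: "X \<in> Con i"
    using ent_typed assms by blast
  have "ent i {i} a"
  proof (cases "X = {i}")
    case True
    then show ?thesis using assms by simp
  next
    case False
    then show ?thesis
      using cut[OF assms(1) Con_self[OF assms(1)] X _ assms(2)] strong[OF assms(1) X] by blast
  qed
  then show ?thesis
    using assms(1) by (simp add: props_iff)
qed

text \<open>This supplies the accessibility premise of \<open>Con_transfer\<close> and
  \<open>ent_transfer\<close> whenever \<open>e\<close> is entailed in \<open>i\<close>.\<close>

lemma Con_singleton_of_ent:
  assumes "i \<in> A" and "ent i X e"
  shows "{e} \<in> Con i"
  using Con_props[OF assms(1), of "{e}"] ent_props[OF assms] by (simp add: Fpow_def)

lemma weaken: "\<lbrakk>i \<in> A; Y \<in> Con i; X \<subseteq> Y; ent i X a\<rbrakk> \<Longrightarrow> ent i Y a"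
  using ent_typed ent_weaken by blast

lemma ent_empty_truth: "i \<in> A \<Longrightarrow> ent i {} t"
  using truth by (simp add: truth_element_def)

lemma ent_truth:
  assumes "i \<in> A" and "X \<in> Con i"
  shows "ent i X t"
  using weaken[OF assms _ ent_empty_truth[OF assms(1)]] by simp

lemma truth_in_props: "i \<in> A \<Longrightarrow> t \<in> props i"
  using ent_empty_truth ent_props by blast

lemma Con_truth: "i \<in> A \<Longrightarrow> {t} \<in> Con i"
  using ent_empty_truth Con_singleton_of_ent by blast

lemma Con_empty: "i \<in> A \<Longrightarrow> {} \<in> Con i"
  using Con_self Con_mono by blast

text \<open>A cut removes \<open>t\<close>, which the empty set entails, and weakening adds it back.
  Reading the empty antecedent as \<open>{t}\<close> therefore does not affect entailment.\<close>

lemma ent_truth_iff: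
  assumes "i \<in> A"
  shows "ent i {t} a \<longleftrightarrow> ent i {} a"
  using cut[OF assms Con_empty Con_truth] weaken[OF assms Con_truth] ent_empty_truth assms
  by blast

section \<open>Derivability as entailment between sets of atoms\<close>

lemma antecedent_atoms_Con:
  assumes "i \<in> A" and "\<Gamma> \<in> antecedents props i"
  shows "(\<Union>\<phi>\<in>\<Gamma>. atoms \<phi>) \<in> Con i"
  using assms Con_self Con_props[OF assms(1) Fpow_formulae_atoms]
  by (auto simp: antecedents_def)

lemma ent_atoms_of_set:
  assumes "i \<in> A"
  shows "ent i (atoms_of_set t \<Gamma>) b \<longleftrightarrow> ent i (\<Union>\<phi>\<in>\<Gamma>. atoms \<phi>) b"
  using ent_truth_iff[OF assms] by (simp add: atoms_of_set_def)

lemma atoms_of_set_Con: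
  assumes "i \<in> A" and "\<Gamma> \<in> antecedents props i"
  shows "atoms_of_set t \<Gamma> \<in> Con i"
  using antecedent_atoms_Con[OF assms] Con_truth[OF assms(1)] by (simp add: atoms_of_set_def)

lemma formulae_props_subset: "formulae (props i) \<subseteq> formulae A"
  using props_subset by (force simp: formulae_iff)

text \<open>The other conditions in the definition follow: admissible antecedents have consistent
  atoms, and by \<open>ent_props\<close> entailed atoms already lie in
  \<open>props i\<close>.\<close>

lemma derives_iff:
  assumes "i \<in> A"
  shows "derives i \<Gamma> \<phi> \<longleftrightarrow>
    \<Gamma> \<in> antecedents props i \<and> (\<forall>b\<in>atoms \<phi>. ent i (\<Union>\<psi>\<in>\<Gamma>. atoms \<psi>) b)"
    (is "_ \<longleftrightarrow> ?R")
proof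
  assume "derives i \<Gamma> \<phi>"
  then show ?R
    using assms by (simp add: frame_turnstile_def frame_entails_def ent_atoms_of_set)
next
  assume R: ?R
  then have "\<phi> \<in> formulae (props i)"
    using ent_props assms by (auto simp: formulae_iff)
  moreover have "\<Gamma> \<in> Fpow (formulae A) \<or> \<Gamma> = {Atom i}"
    using R formulae_props_subset by (auto simp: antecedents_def Fpow_def)
  ultimately show "derives i \<Gamma> \<phi>"
    using R assms atoms_of_set_Con formulae_props_subset
    by (auto simp: frame_turnstile_def frame_entails_def ent_atoms_of_set)
qed

section \<open>Transfer between strata\<close>

lemma Atom_antecedent: "{Atom i} \<in> antecedents props i"
  by (simp add: antecedents_def)

lemma Fpow_antecedent: "\<Gamma> \<in> Fpow (formulae (props i)) \<Longrightarrow> \<Gamma> \<in> antecedents props i"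
  by (simp add: antecedents_def)

text \<open>An entailment from \<open>{p}\<close> in \<open>p\<close> transfers to \<open>q\<close>,
  where \<open>ent_props\<close> replaces the antecedent \<open>{p}\<close> by
  \<open>{q}\<close>.\<close>

lemma props_mono:
  assumes "p \<in> A" and "q \<in> A" and "ent q {q} p"
  shows "props p \<subseteq> props q"
proof
  fix a assume "a \<in> props p"
  then have "ent p {p} a" and "a \<in> A"
    using assms(1) props_iff props_subset by blast+
  then have "ent q {p} a"
    using ent_transfer Con_singleton_of_ent Con_self assms by blast
  then show "a \<in> props q"
    using ent_props assms(2) by blast
qed

lemma derives_transfer:
  assumes "p \<in> A" and "q \<in> A" and "ent q {q} p" and "derives p \<Gamma> \<theta>"
  shows "derives q \<Gamma> \<theta>"
proof -
  have \<Gamma>: "\<Gamma> \<in> antecedents props p"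
    and ent: "\<forall>b\<in>atoms \<theta>. ent p (\<Union>\<psi>\<in>\<Gamma>. atoms \<psi>) b"
    using assms(1,4) by (simp_all add: derives_iff)
  \<comment> \<open>This handles the exceptional antecedent \<open>{Atom p}\<close>, which in
    \<open>q\<close> counts as a set of formulae over \<open>props q\<close>.\<close>
  have "p \<in> props q"
    using assms by (simp add: props_iff)
  then have "\<Gamma> \<in> antecedents props q"
    using \<Gamma> props_mono[OF assms(1-3)] by (auto simp: antecedents_def Fpow_def formulae_iff)
  moreover have "\<forall>b\<in>atoms \<theta>. ent q (\<Union>\<psi>\<in>\<Gamma>. atoms \<psi>) b"
    using ent ent_transfer[OF assms(1,2)] ent_typed[OF assms(1)]
      Con_singleton_of_ent[OF assms(2,3)] by blast
  ultimately show ?thesis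
    using assms(2) by (simp add: derives_iff)
qed

section \<open>Interpolation\<close>

lemma derives_interpolate:
  assumes p: "p \<in> A" and der: "derives p \<Gamma> \<phi>"
  shows "\<exists>r\<in>props p. \<exists>\<xi>\<in>formulae (props r). derives p \<Gamma> (Atom r \<^bold>\<and> \<xi>) \<and> derives r {\<xi>} \<phi>"
proof -
  define U where "U = (\<Union>\<psi>\<in>\<Gamma>. atoms \<psi>)"
  have \<Gamma>: "\<Gamma> \<in> antecedents props p" and ent: "\<forall>b\<in>atoms \<phi>. ent p U b"
    using p der by (simp_all add: derives_iff U_def)
  have U: "U \<in> Con p"
    unfolding U_def using antecedent_atoms_Con[OF p \<Gamma>] .
  have \<phi>: "atoms \<phi> \<in> Fpow A"
    using ent ent_typed[OF p] by (auto simp: Fpow_def)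
  obtain e Z where e: "e \<in> A" and Z: "Z \<in> Con e"
    and Ue: "ent p U e" and UZ: "\<forall>b\<in>Z. ent p U b" and Z\<phi>: "\<forall>b\<in>atoms \<phi>. ent e Z b"
    using ent_interpolate[OF p U \<phi> ent] by blast
  \<comment> \<open>The witness for \<open>r\<close> remains \<open>e\<close>, and \<open>Z'\<close>
    supplies the atoms of \<xi>. The token \<open>e'\<close> serves only to transfer entailments
    from \<open>e'\<close> back to \<open>e\<close>.\<close>
  obtain e' Z' where e': "e' \<in> A" and Z': "Z' \<in> Con e'"
    and Ze': "ent e Z e'" and ZZ': "\<forall>b\<in>Z'. ent e Z b" and Z'\<phi>: "\<forall>b\<in>atoms \<phi>. ent e' Z' b"
    using ent_interpolate[OF e Z \<phi> Z\<phi>] by blast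
  have e_p: "{e} \<in> Con p" and e'_e: "{e'} \<in> Con e"
    using Con_singleton_of_ent p Ue e Ze' by blast+
  have "finite Z'"
    using Con_subset[OF e'] Z' by (auto simp: Fpow_def)
  \<comment> \<open>\<open>Z'\<close> may be empty, so \<open>t\<close> is inserted to have a
    nonempty set of atoms. It is harmless, being entailed by every consistent set.\<close>
  then obtain \<xi> where \<xi>: "atoms \<xi> = insert t Z'"
    using ex_formula_with_atoms[of "insert t Z'"] by blast
  have \<xi>_props: "\<xi> \<in> formulae (props e)"
    using ZZ' ent_props[OF e] truth_in_props[OF e] by (auto simp: \<xi> formulae_iff)
  \<comment> \<open>The entailment from \<open>Z\<close> moves from \<open>e\<close> to
    \<open>p\<close>, where a cut replaces \<open>Z\<close> by \<open>U\<close>.\<close>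
  have "ent p U b" if "b \<in> Z'" for b
  proof -
    have "ent p Z b"
      using ZZ' that ent_transfer[OF e p _ e_p Z] ent_typed[OF e] by blast
    then show ?thesis
      using cut[OF p U _ UZ] ent_typed[OF p] by blast
  qed
  then have "derives p \<Gamma> (Atom e \<^bold>\<and> \<xi>)"
    using p \<Gamma> Ue ent_truth[OF p U] by (auto simp: derives_iff \<xi> simp flip: U_def)
  moreover have "derives e {\<xi>} \<phi>"
  proof -
    have \<xi>_ant: "{\<xi>} \<in> antecedents props e"
      using \<xi>_props by (auto intro: Fpow_antecedent simp: Fpow_def)
    have "ent e (atoms \<xi>) b" if "b \<in> atoms \<phi>" for b
    proof (rule weaken[OF e])
      show "ent e Z' b"
        using that Z'\<phi> ent_transfer[OF e' e _ e'_e Z'] ent_typed[OF e'] by blast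
      show "atoms \<xi> \<in> Con e"
        using antecedent_atoms_Con[OF e \<xi>_ant] by simp
    qed (auto simp: \<xi>)
    then show ?thesis
      using e \<xi>_ant by (simp add: derives_iff)
  qed
  ultimately show ?thesis
    using ent_props[OF p Ue] \<xi>_props by blast
qed

section \<open>Cut, weakening and left conjunction\<close>

lemma derives_cut:
  assumes "p \<in> A" and "derives p \<Gamma> \<phi>" and "derives p {\<phi>} \<psi>"
  shows "derives p \<Gamma> \<psi>"
proof -
  have \<Gamma>: "\<Gamma> \<in> antecedents props p" and \<phi>: "{\<phi>} \<in> antecedents props p"
    using assms by (simp_all add: derives_iff)
  have "ent p (\<Union>\<chi>\<in>\<Gamma>. atoms \<chi>) b" if "b \<in> atoms \<psi>" for b
    by (rule cut[OF assms(1) antecedent_atoms_Con[OF assms(1) \<Gamma>]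
          antecedent_atoms_Con[OF assms(1) \<phi>]])
      (use assms that in \<open>simp_all add: derives_iff\<close>)
  then show ?thesis
    using assms(1) \<Gamma> by (simp add: derives_iff)
qed

lemma derives_weaken:
  assumes p: "p \<in> A" and \<Delta>: "\<Delta> \<in> Fpow (formulae (props p))" and \<xi>: "\<xi> \<in> formulae (props p)"
    and der: "derives p \<Delta> \<phi>"
  shows "derives p (\<Delta> \<union> {\<xi>}) \<phi>"
proof -
  have ant: "\<Delta> \<union> {\<xi>} \<in> antecedents props p"
    using \<Delta> \<xi> by (auto intro: Fpow_antecedent simp: Fpow_def)
  have "ent p (\<Union>\<psi>\<in>\<Delta> \<union> {\<xi>}. atoms \<psi>) b" if "b \<in> atoms \<phi>" for b
    by (rule weaken[OF p antecedent_atoms_Con[OF p ant], of "\<Union>\<psi>\<in>\<Delta>. atoms \<psi>"])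
      (use der that p in \<open>auto simp: derives_iff\<close>)
  then show ?thesis
    using p ant by (simp add: derives_iff)
qed

text \<open>Both antecedents are admissible and have the same atoms, and the entailment in
  \<open>derives_iff\<close> depends only on these.\<close>

lemma derives_L_and:
  assumes "p \<in> A" and "\<Delta> \<in> Fpow (formulae (props p))"
    and "\<phi> \<in> formulae (props p)" and "\<psi> \<in> formulae (props p)"
  shows "derives p (\<Delta> \<union> {\<phi>, \<psi>}) \<theta> \<longleftrightarrow> derives p (\<Delta> \<union> {\<phi> \<^bold>\<and> \<psi>}) \<theta>"
proof -
  have "\<Delta> \<union> {\<phi>, \<psi>} \<in> antecedents props p" "\<Delta> \<union> {\<phi> \<^bold>\<and> \<psi>} \<in> antecedents props p"
    using assms by (auto intro!: Fpow_antecedent formulae.And simp: Fpow_def)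
  moreover have "(\<Union>\<chi>\<in>\<Delta> \<union> {\<phi>, \<psi>}. atoms \<chi>) = (\<Union>\<chi>\<in>\<Delta> \<union> {\<phi> \<^bold>\<and> \<psi>}. atoms \<chi>)"
    by auto
  ultimately show ?thesis
    using assms(1) by (simp only: derives_iff)
qed

section \<open>The logic of the frame and its agreement with entailment\<close>

lemma frame_logic: "continuous_stratified_conjunctive_logic A t props derives"
proof unfold_locales
  fix p \<Gamma> assume p: "p \<in> A" and \<Gamma>: "\<Gamma> \<in> antecedents props p"
  show "derives p \<Gamma> (Atom t)"
    using p \<Gamma> ent_truth antecedent_atoms_Con by (simp add: derives_iff)
  fix \<phi> \<psi>
  show "derives p \<Gamma> \<phi> \<and> derives p \<Gamma> \<psi> \<longleftrightarrow> derives p \<Gamma> (\<phi> \<^bold>\<and> \<psi>)"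
    using p by (auto simp: derives_iff)
next
  fix p q assume pq: "p \<in> A" "q \<in> A" and der: "derives q {Atom q} (Atom p)"
  then show "props p \<subseteq> props q"
    using props_mono by (simp add: derives_iff)
  fix \<Gamma> \<theta> assume "derives p \<Gamma> \<theta>"
  then show "derives q \<Gamma> \<theta>"
    using pq der derives_transfer by (auto simp: derives_iff)
next
  fix p q assume "p \<in> A" "q \<in> props p"
  then show "derives p {Atom p} (Atom q)"
    by (simp add: derives_iff Atom_antecedent props_iff)
next
  fix p \<Gamma> \<phi> assume "derives p \<Gamma> \<phi>"
  then show "\<Gamma> \<in> antecedents props p \<and> \<phi> \<in> formulae (props p)"
    by (simp add: frame_turnstile_def)
qed (rule t_in props_subset derives_L_and derives_weaken derives_interpolate derives_cut;
  assumption)+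

lemma derives_big_and:
  assumes i: "i \<in> A" and X: "X \<in> Con i" and ent: "\<forall>b\<in>Y. ent i X b"
  shows "Atom ` X \<in> antecedents props i"
    and "set \<phi>s = Atom ` Y \<Longrightarrow> derives i (Atom ` X) (big_and t \<phi>s)"
proof -
  show ant: "Atom ` X \<in> antecedents props i"
    using Con_cases[OF i X] by (auto simp: antecedents_def Fpow_def formulae_iff)
  assume "set \<phi>s = Atom ` Y"
  \<comment> \<open>Only an inclusion is available: for empty \<open>Y\<close> the conjunction is
    \<open>Atom t\<close>. The extra atom \<open>t\<close> is entailed by
    \<open>ent_truth\<close>.\<close>
  then have "atoms (big_and t \<phi>s) \<subseteq> insert t Y"
    by (auto simp: atoms_big_and atoms_of_set_def)
  then show "derives i (Atom ` X) (big_and t \<phi>s)"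
    using i ant ent ent_truth[OF i X] by (auto simp: derives_iff)
qed

end

theorem theorem8p1:
  fixes A :: "'a set"
    and Con :: "'a \<Rightarrow> 'a set set"
    and ent :: "'a \<Rightarrow> 'a set \<Rightarrow> 'a \<Rightarrow> bool"
    and t :: 'a
  assumes "strong_continuous_information_frame A Con ent"
    and "truth_element A ent t"
  shows "continuous_stratified_conjunctive_logic A t (frame_props A ent)
           (frame_turnstile A Con ent t) \<and>
    (\<forall>i\<in>A.
      (\<forall>\<Gamma>\<in>antecedents (frame_props A ent) i. \<forall>\<phi>\<in>formulae (frame_props A ent i).
        frame_turnstile A Con ent t i \<Gamma> \<phi> \<longrightarrow>
          atoms_of_set t \<Gamma> \<in> Con i \<and> (\<forall>b\<in>atoms \<phi>. ent i (atoms_of_set t \<Gamma>) b)) \<and>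
      (\<forall>X\<in>Con i. \<forall>Y\<in>Fpow A.
        (\<forall>b\<in>Y. ent i X b) \<longrightarrow>
          Atom ` X \<in> antecedents (frame_props A ent) i \<and>
          (\<forall>\<phi>s. distinct \<phi>s \<and> set \<phi>s = Atom ` Y \<longrightarrow>
            frame_turnstile A Con ent t i (Atom ` X) (big_and t \<phi>s))))"
proof -
  interpret strong_frame_with_truth A Con ent t
    using assms by (simp add: strong_frame_with_truth_def strong_frame_with_truth_axioms_def)
  show ?thesis
  proof (intro conjI ballI allI impI)
    show "continuous_stratified_conjunctive_logic A t props derives"
      by (fact frame_logic)
  next
    fix i \<Gamma> \<phi> assume "derives i \<Gamma> \<phi>"
    then show "atoms_of_set t \<Gamma> \<in> Con i" and "\<And>b. b \<in> atoms \<phi> \<Longrightarrow> ent i (atoms_of_set t \<Gamma>) b"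
      by (simp_all add: frame_turnstile_def frame_entails_def)
  next
    fix i X Y assume "i \<in> A" "X \<in> Con i" "\<forall>b\<in>Y. ent i X b"
    note big_and = derives_big_and[OF this]
    show "Atom ` X \<in> antecedents props i"
      by (fact big_and)
    fix \<phi>s assume "distinct \<phi>s \<and> set \<phi>s = Atom ` Y"
    then show "derives i (Atom ` X) (big_and t \<phi>s)"
      using big_and by blast
  qed
qed

end
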